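(* Let $m,n,k\in\mathbb{N}$, let $\varepsilon\geq 0$, and let $\mathbf{X}$ be a random matrix in $\mathbb{R}^{m\times n}$ with arbitrary distribution. Let $\mathcal{S}\subseteq\mathbb{R}^{m\times n}$ be an $\varepsilon$-support set of $\mathbf{X}$ and suppose $k>\underline{\dim}_\mathrm{B}(\mathcal{S})$. Then for Lebesgue almost all $(\mathbf{a}_1,\mathbf{b}_1,\dots,\mathbf{a}_k,\mathbf{b}_k)$ with $\mathbf{a}_i\in\mathbb{R}^m$, $\mathbf{b}_i\in\mathbb{R}^n$, setting $\mathbf{A}_i=\mathbf{a}_i\mathbf{b}_i^T$ ($i=1,\dots,k$), there exists a measurable map (decoder) $g:\mathbb{R}^k\to\mathbb{R}^{m\times n}$ such that $$\Pr\Big[g\big((\langle \mathbf{A}_1,\mathbf{X}\rangle,\dots,\langle \mathbf{A}_k,\mathbf{X}\rangle)^{T}\big)\neq \mathbf{X}\Big]\leq\varepsilon.$$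
   Context: For $\mathbf{A},\mathbf{B}\in\mathbb{R}^{m\times n}$, $\langle \mathbf{A},\mathbf{B}\rangle=\operatorname{tr}(\mathbf{A}^T\mathbf{B})$ and $\|\mathbf{A}\|_2=\sqrt{\langle\mathbf{A},\mathbf{A}\rangle}$. For $\varepsilon\ge 0$, a nonempty bounded set $\mathcal{S}\subseteq\mathbb{R}^{m\times n}$ is called an $\varepsilon$-support set of the random matrix $\mathbf{X}$ if $\Pr[\mathbf{X}\in\mathcal{S}]\geq 1-\varepsilon$. For a nonempty bounded set $\mathcal{S}\subseteq\mathbb{R}^{m\times n}$, let $N_\mathcal{S}(\rho)$ be the minimal number of open $\|\cdot\|_2$-balls of radius $\rho$ (with centers in $\mathbb{R}^{m\times n}$) needed to cover $\mathcal{S}$; the lower Minkowski dimension is $\underline{\dim}_\mathrm{B}(\mathcal{S})=\liminf_{\rho\to0}\frac{\log N_\mathcal{S}(\rho)}{\log(1/\rho)}$. *)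

theory Defs
  imports "HOL-Probability.Probability"
begin

text \<open>Matrices in R^(m x n) are rendered as real^'n^'m (row index 'm, column index 'n).\<close>

definition frob_inner :: "real^'n^'m \<Rightarrow> real^'n^'m \<Rightarrow> real" where
  "frob_inner A B = (\<Sum>i\<in>UNIV. \<Sum>j\<in>UNIV. A $ i $ j * B $ i $ j)"

definition frob_norm :: "real^'n^'m \<Rightarrow> real" where
  "frob_norm A = sqrt (frob_inner A A)"

definition outer :: "real^'m \<Rightarrow> real^'n \<Rightarrow> real^'n^'m" where
  "outer a b = (\<chi> i j. a $ i * b $ j)"

definition covering_number :: "(real^'n^'m) set \<Rightarrow> real \<Rightarrow> nat" where
  "covering_number S \<rho> =
     (LEAST N. \<exists>C. finite C \<and> card C = N \<and> S \<subseteq> (\<Union>c\<in>C. {Y. frob_norm (Y - c) < \<rho>}))"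

definition lower_box_dim :: "(real^'n^'m) set \<Rightarrow> ereal" where
  "lower_box_dim S =
     Liminf (at_right 0) (\<lambda>\<rho>. ereal (ln (real (covering_number S \<rho>)) / ln (1 / \<rho>)))"

definition eps_support :: "'a measure \<Rightarrow> ('a \<Rightarrow> real^'n^'m) \<Rightarrow> real \<Rightarrow> (real^'n^'m) set \<Rightarrow> bool" where
  "eps_support M X \<epsilon> S \<longleftrightarrow> S \<noteq> {} \<and> bounded S \<and>
     {\<omega> \<in> space M. X \<omega> \<in> S} \<in> sets M \<and>
     measure M {\<omega> \<in> space M. X \<omega> \<in> S} \<ge> 1 - \<epsilon>"

end

theory Submission
  imports Defs
begin

text \<open>Replacing \<open>S\<close> by its closure \<open>K\<close> affects neither the covering bounds nor the lower bound on
  the probability, so the support set may be taken compact. For a fixed matrix \<open>D \<noteq> 0\<close> and \<open>s < 1\<close>,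
  the function \<open>\<bar>a \<bullet> D b\<bar> powr - s\<close> has integral at most \<open>C\<close> over a product of balls, so by Markov's
  inequality \<open>{\<bar>a \<bullet> D b\<bar> \<le> \<tau>}\<close> has measure at most \<open>C * \<tau> powr s\<close> there, uniformly for \<open>D\<close> bounded away
  from \<open>0\<close>. With \<open>k\<close> independent measurements this becomes \<open>\<tau> powr (s * k)\<close> up to a constant, which beats
  the number of balls of radius about \<open>\<tau>\<close> covering \<open>K\<close>. Hence, for each fixed \<open>x\<close>, almost all measurements
  separate \<open>x\<close> from every other point of \<open>K\<close>; by Fubini almost all measurements do so for almost every
  value \<open>x\<close> of \<open>X\<close>. (Uniform injectivity on \<open>K\<close> would need the dimension of \<open>K - K\<close> instead.) The decoder
  takes, coordinate by coordinate, the minimum over the fibre in \<open>K\<close>; these minima are lower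
  semicontinuous, hence measurable.\<close>

section \<open>The singular kernel and its integrals along a line and over a ball\<close>

text \<open>The inverse is taken in \<^typ>\<open>ennreal\<close>, so that the value at \<open>0\<close> is \<open>top\<close>, whereas
  \<open>0 powr - s = 0\<close>.\<close>

definition riesz :: "real \<Rightarrow> real \<Rightarrow> ennreal" where
  "riesz s u = inverse (ennreal (\<bar>u\<bar> powr s))"

lemma borel_measurable_riesz [measurable (raw)]:
  "f \<in> borel_measurable M \<Longrightarrow> (\<lambda>x. riesz s (f x)) \<in> borel_measurable M"
  unfolding riesz_def by measurable

lemma cball_in_sets_borel [measurable]: "cball x r \<in> sets borel"
  by (intro borel_closed closed_cball)

lemma riesz_zero [simp]: "riesz s 0 = top"
  by (simp add: riesz_def)

lemma riesz_nonzero: "u \<noteq> 0 \<Longrightarrow> riesz s u = ennreal (\<bar>u\<bar> powr - s)"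
  by (simp add: riesz_def inverse_ennreal powr_minus)

text \<open>Zero arguments need no exception: powers of real numbers are finite, so
  \<open>riesz\<close> never vanishes and \<open>top\<close> times the other factor is again
  \<open>top\<close>.\<close>

lemma riesz_mult: "riesz s (u * v) = riesz s u * riesz s v"
  unfolding riesz_def
  by (simp add: abs_mult powr_mult ennreal_mult ennreal_inverse_mult)

lemma riesz_antimono: "0 \<le> s \<Longrightarrow> \<bar>u\<bar> \<le> \<bar>v\<bar> \<Longrightarrow> riesz s v \<le> riesz s u"
  by (cases "u = 0"; cases "v = 0")
    (auto simp: riesz_nonzero intro!: ennreal_leI powr_mono2')

text \<open>On \<open>{0..1}\<close> the antiderivative \<open>u powr (1 - s) / (1 - s)\<close>
  stays finite down to 0 because \<open>s < 1\<close>; the negative half follows by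
  reflection.\<close>

lemma riesz_near_zero_finite:
  assumes "s < 1"
  shows "(\<integral>\<^sup>+u\<in>{-1..1}. riesz s u \<partial>lborel) < top"
proof -
  have pos: "(\<integral>\<^sup>+u\<in>{0..1}. riesz s u \<partial>lborel) < top"
  proof -
    have "((\<lambda>u::real. u powr (-s)) has_integral (1 powr (-s + 1) / (-s + 1))) {0..1}"
      using assms by (intro has_integral_powr_from_0) auto
    then have "(\<integral>\<^sup>+u. ennreal (u powr (-s)) * indicator {0..1} u \<partial>lborel) = ennreal (1 powr (-s + 1) / (-s + 1))"
      by (intro nn_integral_has_integral_lebesgue') auto
    \<comment> \<open>Under the indicator the two integrands differ at 0 only, where the kernel is
      \<open>top\<close> and the real power is 0.\<close>
    moreover have "(\<integral>\<^sup>+u\<in>{0..1}. riesz s u \<partial>lborel) = (\<integral>\<^sup>+u. ennreal (u powr (-s)) * indicator {0..1} u \<partial>lborel)"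
      using AE_lborel_singleton[of "0::real"]
      by (intro nn_integral_cong_AE) (auto elim!: eventually_mono simp: riesz_nonzero indicator_def)
    ultimately show ?thesis by simp
  qed
  have "(\<integral>\<^sup>+u\<in>{-1..0}. riesz s u \<partial>lborel) = (\<integral>\<^sup>+u\<in>{0..1}. riesz s u \<partial>lborel)"
    by (subst nn_integral_real_affine[where c = "-1" and t = 0])
      (auto intro!: nn_integral_cong simp: riesz_def indicator_def)
  moreover have "(\<integral>\<^sup>+u\<in>{-1..1}. riesz s u \<partial>lborel)
      \<le> (\<integral>\<^sup>+u. riesz s u * indicator {-1..0} u + riesz s u * indicator {0..1} u \<partial>lborel)"
    by (intro nn_integral_mono) (auto simp: indicator_def)
  moreover have "\<dots> = (\<integral>\<^sup>+u\<in>{-1..0}. riesz s u \<partial>lborel) + (\<integral>\<^sup>+u\<in>{0..1}. riesz s u \<partial>lborel)"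
    by (intro nn_integral_add) auto
  ultimately show ?thesis using pos
    by (auto simp: order.strict_iff_order top_unique)
qed

text \<open>The summand 1 pays for the part of a unit interval where the kernel is at most 1. It
  also makes the constant positive, so that its product with \<open>riesz s 0\<close> is
  \<open>top\<close>.\<close>

definition riesz_const :: "real \<Rightarrow> ennreal" where
  "riesz_const s = (\<integral>\<^sup>+u\<in>{-1..1}. riesz s u \<partial>lborel) + 1"

lemma riesz_const_pos: "0 < riesz_const s"
  unfolding riesz_const_def by (simp add: add_nonneg_pos)

lemma riesz_const_finite: "s < 1 \<Longrightarrow> riesz_const s < top"
  using riesz_near_zero_finite[of s] by (simp add: riesz_const_def)

text \<open>The bound must be uniform in the offset \<open>d\<close>. For \<open>c = 0\<close> the
  right side is \<open>top\<close>. Otherwise \<open>riesz s c\<close> factors out and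
  \<open>riesz s (e + t)\<close> remains: where \<open>e + t\<close> lies in \<open>{-1..1}\<close>,
  translation gives the integral near 0; elsewhere the kernel is at most 1.\<close>

lemma nn_integral_riesz_affine_le:
  assumes "0 \<le> s"
  shows "(\<integral>\<^sup>+t\<in>{0..1}. riesz s (d + c * t) \<partial>lborel) \<le> riesz_const s * riesz s c"
proof (cases "c = 0")
  case True
  then show ?thesis using riesz_const_pos[of s] by (simp add: ennreal_mult_top)
next
  case False
  define e where "e = d / c"
  have "(\<integral>\<^sup>+t\<in>{0..1}. riesz s (d + c * t) \<partial>lborel)
      = (\<integral>\<^sup>+t. riesz s c * (riesz s (e + t) * indicator {0..1} t) \<partial>lborel)"
    using False
    by (intro nn_integral_cong) (auto simp: e_def riesz_mult[symmetric] mult.assoc[symmetric] distrib_left)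
  also have "\<dots> = riesz s c * (\<integral>\<^sup>+t. riesz s (e + t) * indicator {0..1} t \<partial>lborel)"
    by (intro nn_integral_cmult) measurable
  finally have scale: "(\<integral>\<^sup>+t\<in>{0..1}. riesz s (d + c * t) \<partial>lborel)
      = riesz s c * (\<integral>\<^sup>+t. riesz s (e + t) * indicator {0..1} t \<partial>lborel)" .
  have "(\<integral>\<^sup>+t. riesz s (e + t) * indicator {0..1} t \<partial>lborel)
      \<le> (\<integral>\<^sup>+t. riesz s (e + t) * indicator {-1..1} (e + t) + indicator {0..1} t \<partial>lborel)"
  proof (intro nn_integral_mono)
    fix t :: real
    have "riesz s (e + t) \<le> riesz s 1" if "e + t \<notin> {-1..1}"
      using that assms by (intro riesz_antimono) auto
    then show "riesz s (e + t) * indicator {0..1} t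
        \<le> riesz s (e + t) * indicator {-1..1} (e + t) + indicator {0..1} t"
      by (auto simp: indicator_def riesz_def)
  qed
  also have "\<dots> = (\<integral>\<^sup>+t. riesz s (e + t) * indicator {-1..1} (e + t) \<partial>lborel) + (\<integral>\<^sup>+t. indicator {0..1::real} t \<partial>lborel)"
    by (intro nn_integral_add) auto
  also have "(\<integral>\<^sup>+t. riesz s (e + t) * indicator {-1..1} (e + t) \<partial>lborel)
      = (\<integral>\<^sup>+u\<in>{-1..1}. riesz s u \<partial>lborel)"
    by (subst (2) nn_integral_real_affine[where c = 1 and t = e]) auto
  also have "(\<integral>\<^sup>+t. indicator {0..1::real} t \<partial>lborel) = 1"
    by simp
  finally show ?thesis
    unfolding scale riesz_const_def by (subst mult.commute) (rule mult_right_mono, auto)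
qed

text \<open>By translation invariance the integral may be averaged over the translates by \<open>t *\<^sub>R u\<close>
  with \<open>u = c / norm c\<close> and \<open>0 \<le> t \<le> 1\<close>, which leaves a one-dimensional integral.\<close>

lemma nn_integral_riesz_inner_le:
  fixes c :: "'a::euclidean_space"
  assumes s: "0 \<le> s" and R: "0 \<le> R"
  shows "(\<integral>\<^sup>+a\<in>cball 0 R. riesz s (a \<bullet> c) \<partial>lborel)
           \<le> emeasure lborel (cball (0::'a) (R + 1)) * riesz_const s * riesz s (norm c)"
proof (cases "c = 0")
  case True
  have "0 < emeasure lborel (cball (0::'a) (R + 1))"
    using R by (simp add: emeasure_cball ennreal_zero_less_mult_iff unit_ball_vol_pos)
  then show ?thesis using True riesz_const_pos[of s]
    by (simp add: ennreal_mult_top zero_less_iff_neq_zero)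
next
  case False
  define u where "u = c /\<^sub>R norm c"
  have u: "norm u = 1" "u \<bullet> c = norm c"
    using False by (auto simp: u_def dot_square_norm power2_eq_square)
  have shift: "(\<integral>\<^sup>+a\<in>cball 0 R. riesz s (a \<bullet> c) \<partial>lborel)
      = (\<integral>\<^sup>+a. riesz s (a \<bullet> c + norm c * t) * indicator (cball 0 R) (t *\<^sub>R u + a) \<partial>lborel)" for t
    by (subst lborel_distr_plus[of "t *\<^sub>R u", symmetric], subst nn_integral_distr)
      (auto intro!: nn_integral_cong simp: inner_add_left u algebra_simps)
  have "(\<integral>\<^sup>+a\<in>cball 0 R. riesz s (a \<bullet> c) \<partial>lborel)
      = (\<integral>\<^sup>+t. (\<integral>\<^sup>+a\<in>cball 0 R. riesz s (a \<bullet> c) \<partial>lborel) * indicator {0..1} t \<partial>(lborel::real measure))"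
    by (subst nn_integral_cmult) auto
  also have "\<dots> = (\<integral>\<^sup>+t. \<integral>\<^sup>+a. riesz s (a \<bullet> c + norm c * t) * indicator (cball 0 R) (t *\<^sub>R u + a) * indicator {0..1} t \<partial>lborel \<partial>(lborel::real measure))"
    by (intro nn_integral_cong, subst shift, subst nn_integral_multc) auto
  also have "\<dots> = (\<integral>\<^sup>+a. \<integral>\<^sup>+t. riesz s (a \<bullet> c + norm c * t) * indicator (cball 0 R) (t *\<^sub>R u + a) * indicator {0..1} t \<partial>(lborel::real measure) \<partial>lborel)"
    by (intro lborel_pair.Fubini') measurable
  \<comment> \<open>The shift \<open>t *\<^sub>R u\<close> has length at most 1, so enlarging the
    radius to \<open>R + 1\<close> frees the ball indicator from \<open>t\<close>.\<close>
  also have "\<dots> \<le> (\<integral>\<^sup>+a. \<integral>\<^sup>+t. indicator (cball 0 (R + 1)) a * (riesz s (a \<bullet> c + norm c * t) * indicator {0..1} t) \<partial>(lborel::real measure) \<partial>lborel)"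
  proof (intro nn_integral_mono)
    fix a :: 'a and t :: real
    have "norm a \<le> R + 1" if "norm (t *\<^sub>R u + a) \<le> R" "0 \<le> t" "t \<le> 1"
    proof -
      have "norm a \<le> norm (t *\<^sub>R u + a) + norm (t *\<^sub>R u)"
        using norm_triangle_ineq4[of "t *\<^sub>R u + a" "t *\<^sub>R u"] by simp
      then show ?thesis using that u by simp
    qed
    then show "riesz s (a \<bullet> c + norm c * t) * indicator (cball 0 R) (t *\<^sub>R u + a) * indicator {0..1} t
        \<le> indicator (cball 0 (R + 1)) a * (riesz s (a \<bullet> c + norm c * t) * indicator {0..1} t)"
      by (auto simp: indicator_def)
  qed
  also have "\<dots> = (\<integral>\<^sup>+a. indicator (cball 0 (R + 1)) a * (\<integral>\<^sup>+t\<in>{0..1}. riesz s (a \<bullet> c + norm c * t) \<partial>(lborel::real measure)) \<partial>lborel)"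
    by (intro nn_integral_cong nn_integral_cmult) measurable
  also have "\<dots> \<le> (\<integral>\<^sup>+a. indicator (cball 0 (R + 1)) a * (riesz_const s * riesz s (norm c)) \<partial>(lborel::'a measure))"
    using s by (intro nn_integral_mono mult_left_mono nn_integral_riesz_affine_le) auto
  also have "\<dots> = emeasure lborel (cball (0::'a) (R + 1)) * riesz_const s * riesz s (norm c)"
    by (subst nn_integral_multc) (auto simp: mult.assoc)
  finally show ?thesis .
qed

section \<open>Small-value estimate for a single rank-one measurement\<close>

lemma frob_inner_eq_inner: "frob_inner A B = A \<bullet> B"
  by (simp add: frob_inner_def inner_vec_def)

lemma frob_norm_eq_norm: "frob_norm A = norm A"
  by (simp add: frob_norm_def frob_inner_eq_inner norm_eq_sqrt_inner)

lemma inner_outer: "outer a b \<bullet> D = a \<bullet> (D *v b)"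
  by (simp add: outer_def inner_vec_def matrix_vector_mult_def sum_distrib_left ac_simps)

lemma borel_measurable_matrix_vector_mult [measurable (raw)]:
  fixes D :: "real^'n^'m"
  assumes "f \<in> borel_measurable M"
  shows "(\<lambda>x. D *v f x) \<in> borel_measurable M"
  by (rule borel_measurable_continuous_on[OF _ assms]) (intro continuous_intros)

text \<open>The ball estimate is used twice. Integrating over \<open>a\<close> with \<open>b\<close>
  fixed leaves \<open>riesz s (norm (D *v b))\<close>; since the norm dominates the
  \<open>p\<close>-th entry \<open>b \<bullet> (D $ p)\<close>, this is at most the kernel of a
  linear form in \<open>b\<close>, ready for the second integration.\<close>

lemma nn_integral_riesz_bilinear_le:
  fixes D :: "real^'n^'m"
  assumes s: "0 \<le> s" and R: "0 \<le> R"
  shows "(\<integral>\<^sup>+z\<in>cball 0 R \<times> cball 0 R. riesz s (fst z \<bullet> (D *v snd z)) \<partial>lborel)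
     \<le> emeasure lborel (cball (0::real^'m) (R + 1)) * emeasure lborel (cball (0::real^'n) (R + 1))
         * riesz_const s ^ 2 * riesz s (norm (D $ p))"
proof -
  let ?A = "emeasure lborel (cball (0::real^'m) (R + 1))"
  let ?B = "emeasure lborel (cball (0::real^'n) (R + 1))"
  have "(\<integral>\<^sup>+z\<in>cball 0 R \<times> cball 0 R. riesz s (fst z \<bullet> (D *v snd z)) \<partial>lborel)
     = (\<integral>\<^sup>+b. \<integral>\<^sup>+a. riesz s (a \<bullet> (D *v b)) * indicator (cball 0 R) a * indicator (cball 0 R) b \<partial>lborel \<partial>lborel)"
  proof -
    have "(\<lambda>z. riesz s (fst z \<bullet> (D *v snd z)) * (indicator (cball 0 R) (fst z) * indicator (cball 0 R) (snd z)))
        \<in> borel_measurable (lborel \<Otimes>\<^sub>M lborel)"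
      by measurable
    then show ?thesis
      by (subst lborel_prod[symmetric], subst lborel_pair.nn_integral_snd[symmetric])
        (auto simp: indicator_times mult.assoc)
  qed
  also have "\<dots> = (\<integral>\<^sup>+b. (\<integral>\<^sup>+a\<in>cball 0 R. riesz s (a \<bullet> (D *v b)) \<partial>lborel) * indicator (cball 0 R) b \<partial>lborel)"
    by (intro nn_integral_cong nn_integral_multc) measurable
  also have "\<dots> \<le> (\<integral>\<^sup>+b. ?A * riesz_const s * (riesz s (b \<bullet> (D $ p)) * indicator (cball 0 R) b) \<partial>lborel)"
  proof (intro nn_integral_mono)
    fix b :: "real^'n"
    have "(\<integral>\<^sup>+a\<in>cball 0 R. riesz s (a \<bullet> (D *v b)) \<partial>lborel) \<le> ?A * riesz_const s * riesz s (norm (D *v b))"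
      by (intro nn_integral_riesz_inner_le s R)
    also have "riesz s (norm (D *v b)) \<le> riesz s (b \<bullet> (D $ p))"
      using s component_le_norm_cart[of "D *v b" p]
      by (intro riesz_antimono) (auto simp: matrix_vector_mul_component inner_commute)
    finally show "(\<integral>\<^sup>+a\<in>cball 0 R. riesz s (a \<bullet> (D *v b)) \<partial>lborel) * indicator (cball 0 R) b
        \<le> ?A * riesz_const s * (riesz s (b \<bullet> (D $ p)) * indicator (cball 0 R) b)"
      by (auto simp: indicator_def mult_left_mono)
  qed
  also have "\<dots> = ?A * riesz_const s * (\<integral>\<^sup>+b\<in>cball 0 R. riesz s (b \<bullet> (D $ p)) \<partial>lborel)"
    by (intro nn_integral_cmult) measurable
  also have "\<dots> \<le> ?A * riesz_const s * (?B * riesz_const s * riesz s (norm (D $ p)))"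
    by (intro mult_left_mono nn_integral_riesz_inner_le s R) auto
  finally show ?thesis by (simp add: power2_eq_square ac_simps)
qed

lemma emeasure_bilinear_small_le:
  assumes s: "0 < s" "s < 1" and R: "0 \<le> R" and d: "0 < d"
  shows "\<exists>C\<ge>0. \<forall>(D :: real^'n^'m) \<tau>. d \<le> norm D \<longrightarrow> 0 < \<tau> \<longrightarrow>
     emeasure lborel {z \<in> cball 0 R \<times> cball 0 R. \<bar>fst z \<bullet> (D *v snd z)\<bar> \<le> \<tau>} \<le> ennreal (C * \<tau> powr s)"
proof -
  \<comment> \<open>By pigeonhole some row has norm at least \<open>e\<close>, because
    \<open>norm D\<close> is at most the sum of the \<open>CARD('m)\<close> row norms. This makes
    \<open>C'\<close> independent of \<open>D\<close>.\<close>
  define e where "e = d / CARD('m)"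
  have e: "0 < e" using d by (simp add: e_def)
  define C' where "C' = emeasure lborel (cball (0::real^'m) (R + 1))
    * emeasure lborel (cball (0::real^'n) (R + 1)) * riesz_const s ^ 2 * riesz s e"
  have "C' < top"
    unfolding C'_def using e R riesz_const_finite[OF s(2)]
    by (simp add: ennreal_mult_less_top emeasure_cball riesz_nonzero power2_eq_square)
  then obtain C where C: "0 \<le> C" "C' = ennreal C"
    by (cases C' rule: ennreal_cases) auto
  have "emeasure lborel {z \<in> cball 0 R \<times> cball 0 R. \<bar>fst z \<bullet> (D *v snd z)\<bar> \<le> \<tau>} \<le> ennreal (C * \<tau> powr s)"
    if D: "d \<le> norm D" and \<tau>: "0 < \<tau>" for D :: "real^'n^'m" and \<tau>
  proof -
    have "\<exists>p. e \<le> norm (D $ p)"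
    proof (rule ccontr)
      assume "\<not> ?thesis"
      then have "(\<Sum>p\<in>UNIV. norm (D $ p)) < (\<Sum>p\<in>(UNIV::'m set). e)"
        by (intro sum_strict_mono) (auto simp: not_le)
      moreover have "norm D \<le> (\<Sum>p\<in>UNIV. norm (D $ p))"
        unfolding norm_vec_def by (intro L2_set_le_sum) auto
      ultimately show False using D by (simp add: e_def)
    qed
    then obtain p where p: "e \<le> norm (D $ p)" by blast
    have [measurable]: "cball 0 R \<times> cball 0 R \<in> sets (borel :: ((real^'m) \<times> (real^'n)) measure)"
      by (intro borel_closed closed_Times closed_cball)
    have meas: "(\<lambda>z. riesz s (fst z \<bullet> (D *v snd z))) \<in> borel_measurable (borel :: ((real^'m) \<times> (real^'n)) measure)"
      unfolding borel_prod[symmetric] by measurable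
    \<comment> \<open>The factor \<open>\<tau> powr s\<close> brings Markov's inequality to level 1.
      Zeros of the form are included, as the kernel is \<open>top\<close> there.\<close>
    have "1 \<le> ennreal (\<tau> powr s) * riesz s v" if "\<bar>v\<bar> \<le> \<tau>" for v
    proof -
      have "ennreal (\<tau> powr s) * riesz s \<tau> = 1"
        using \<tau> by (simp add: riesz_nonzero ennreal_mult[symmetric] powr_minus)
      then show ?thesis
        using riesz_antimono[of s v \<tau>] that s \<tau> by (metis abs_of_pos less_imp_le mult_left_mono zero_le)
    qed
    then have "emeasure lborel {z \<in> cball 0 R \<times> cball 0 R. \<bar>fst z \<bullet> (D *v snd z)\<bar> \<le> \<tau>}
       \<le> emeasure lborel {z \<in> cball 0 R \<times> cball 0 R. 1 \<le> ennreal (\<tau> powr s) * riesz s (fst z \<bullet> (D *v snd z))}"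
      using meas by (intro emeasure_mono) auto
    also have "\<dots> \<le> ennreal (\<tau> powr s) * (\<integral>\<^sup>+z\<in>cball 0 R \<times> cball 0 R. riesz s (fst z \<bullet> (D *v snd z)) \<partial>lborel)"
      using meas by (intro nn_integral_Markov_inequality) auto
    also have "\<dots> \<le> ennreal (\<tau> powr s) * C'"
    proof (intro mult_left_mono)
      have "riesz s (norm (D $ p)) \<le> riesz s e"
        using p s e by (intro riesz_antimono) auto
      then show "(\<integral>\<^sup>+z\<in>cball 0 R \<times> cball 0 R. riesz s (fst z \<bullet> (D *v snd z)) \<partial>lborel) \<le> C'"
        unfolding C'_def using s R
        by (intro order.trans[OF nn_integral_riesz_bilinear_le[of s R D p]] mult_left_mono) auto
    qed simp
    finally show ?thesis using C by (simp add: ennreal_mult mult.commute)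
  qed
  then show ?thesis using C by blast
qed

lemma norm_outer: "norm (outer a b) = norm a * norm b"
proof -
  have "outer a b \<bullet> outer a b = (a \<bullet> a) * (b \<bullet> b)"
    by (simp add: outer_def inner_vec_def sum_product) (simp add: ac_simps)
  then show ?thesis
    by (simp add: norm_eq_sqrt_inner real_sqrt_mult)
qed

section \<open>Closedness and measurability: projections, finite products, the decoder\<close>

text \<open>Projection along a compact factor is closed, by the tube lemma applied to the complement
  of \<open>T\<close>. This is what makes an existential over the uncountable set \<open>K\<close>
  measurable later.\<close>

lemma closed_exists_compact:
  assumes "compact K" "closed T"
  shows "closed {x. \<exists>y\<in>K. (x, y) \<in> T}"
  unfolding closed_def
proof (rule Topological_Spaces.openI)
  fix x assume "x \<in> - {x. \<exists>y\<in>K. (x, y) \<in> T}"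
  then have "{x} \<times> K \<subseteq> - T" by auto
  then obtain U where "x \<in> U" "open U" "U \<times> K \<subseteq> - T"
    using Elementary_Topology.tube_lemma[of K "- T" x] assms by auto
  then show "\<exists>U. open U \<and> x \<in> U \<and> U \<subseteq> - {x. \<exists>y\<in>K. (x, y) \<in> T}"
    by (intro exI[of _ U]) auto
qed

text \<open>Bridge from the topological function space, where closed sets and Borel decoders live,
  to \<open>PiM\<close>. Points of \<open>PiM\<close> over \<open>I\<close> are constantly
  \<open>undefined\<close> off \<open>I\<close>, so the remaining coordinates are measurable
  too.\<close>

lemma measurable_ident_PiM_borel:
  "(\<lambda>v. v) \<in> measurable (PiM (I :: 'i::countable set) (\<lambda>_. lborel)) (borel :: ('i \<Rightarrow> 'a::euclidean_space) measure)"
proof -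
  have "(\<lambda>v. v) \<in> measurable (PiM I (\<lambda>_. lborel)) (PiM UNIV (\<lambda>_. borel :: 'a measure))"
  proof (rule measurable_PiM_single')
    fix i :: 'i
    show "(\<lambda>v. v i) \<in> borel_measurable (PiM I (\<lambda>_. lborel :: 'a measure))"
    proof (cases "i \<in> I")
      case True
      then show ?thesis by measurable
    next
      case False
      then have "(\<lambda>v. v i) \<in> borel_measurable (PiM I (\<lambda>_. lborel :: 'a measure)) \<longleftrightarrow>
          (\<lambda>v. undefined :: 'a) \<in> borel_measurable (PiM I (\<lambda>_. lborel :: 'a measure))"
        by (intro measurable_cong) (auto simp: space_PiM PiE_def extensional_def)
      then show ?thesis by simp
    qed
  qed (auto simp: space_PiM)
  then show ?thesis
    using measurable_cong_sets[OF refl sets_PiM_equal_borel] by blast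
qed

text \<open>If the fibre through \<open>x\<close> is a singleton, each coordinate minimum is
  attained at \<open>x\<close>. On larger fibres the minima may come from different points, so the
  value of \<open>g\<close> need not lie in the fibre.\<close>

lemma measurable_left_inverse_on_compact:
  fixes \<Phi> :: "'a::euclidean_space \<Rightarrow> 'b::t2_space"
  assumes K: "compact K" and \<Phi>: "continuous_on K \<Phi>"
  shows "\<exists>g \<in> borel_measurable borel. \<forall>x\<in>K. (\<forall>y\<in>K. \<Phi> y = \<Phi> x \<longrightarrow> y = x) \<longrightarrow> g (\<Phi> x) = x"
proof -
  define h where "h = (\<lambda>(b::'a) v. if v \<in> \<Phi> ` K then Inf ((\<lambda>y. y \<bullet> b) ` {y \<in> K. \<Phi> y = v}) else 0)"
  have fibre: "\<exists>y\<in>K. \<Phi> y = v \<and> h b v = y \<bullet> b \<and> (\<forall>z\<in>K. \<Phi> z = v \<longrightarrow> y \<bullet> b \<le> z \<bullet> b)"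
    if v: "v \<in> \<Phi> ` K" for b v
  proof -
    have "closed {y \<in> K. \<Phi> y = v}"
      using K \<Phi> by (intro continuous_closed_preimage_constant compact_imp_closed)
    then have "compact {y \<in> K. \<Phi> y = v}"
      using compact_Int_closed[OF K, of "{y \<in> K. \<Phi> y = v}"] by (simp add: Int_absorb1 subset_eq)
    then have "compact ((\<lambda>y. y \<bullet> b) ` {y \<in> K. \<Phi> y = v})"
      by (intro compact_continuous_image continuous_intros)
    moreover have "(\<lambda>y. y \<bullet> b) ` {y \<in> K. \<Phi> y = v} \<noteq> {}"
      using v by auto
    ultimately obtain m where m: "m \<in> (\<lambda>y. y \<bullet> b) ` {y \<in> K. \<Phi> y = v}"
        "\<forall>u\<in>(\<lambda>y. y \<bullet> b) ` {y \<in> K. \<Phi> y = v}. m \<le> u"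
      using compact_attains_inf by blast
    moreover have "Inf ((\<lambda>y. y \<bullet> b) ` {y \<in> K. \<Phi> y = v}) = m"
      using m by (intro cInf_eq_minimum) auto
    ultimately show ?thesis using v by (auto simp: h_def)
  qed
  have "h b \<in> borel_measurable borel" for b
  proof (rule borel_measurableI_le)
    fix c
    have "closed (\<Phi> ` {y \<in> K. y \<bullet> b \<le> c})"
    proof (intro compact_imp_closed compact_continuous_image)
      show "continuous_on {y \<in> K. y \<bullet> b \<le> c} \<Phi>"
        using \<Phi> by (rule continuous_on_subset) auto
      have "closed {y. y \<bullet> b \<le> c}"
        by (intro closed_Collect_le continuous_intros)
      then show "compact {y \<in> K. y \<bullet> b \<le> c}"
        using compact_Int_closed[OF K, of "{y. y \<bullet> b \<le> c}"] by (simp add: Int_def)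
    qed
    moreover have "closed (\<Phi> ` K)"
      using K \<Phi> by (intro compact_imp_closed compact_continuous_image)
    \<comment> \<open>The default value 0 of \<open>h b\<close> outside the image puts the whole
      complement into the sublevel set as soon as \<open>0 \<le> c\<close>.\<close>
    moreover have "{v \<in> space borel. h b v \<le> c}
        = \<Phi> ` {y \<in> K. y \<bullet> b \<le> c} \<union> (if 0 \<le> c then - \<Phi> ` K else {})" (is "?L = ?R")
    proof (rule set_eqI)
      fix v
      show "v \<in> ?L \<longleftrightarrow> v \<in> ?R"
      proof (cases "v \<in> \<Phi> ` K")
        case True
        from fibre[OF this, of b] obtain y where
          "y \<in> K" "\<Phi> y = v" "h b v = y \<bullet> b" "\<forall>z\<in>K. \<Phi> z = v \<longrightarrow> y \<bullet> b \<le> z \<bullet> b" by blast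
        then show ?thesis by force
      next
        case False
        then show ?thesis by (auto simp: h_def)
      qed
    qed
    ultimately show "{v \<in> space borel. h b v \<le> c} \<in> sets borel"
      by (auto intro!: sets.Un borel_closed borel_open simp: open_Compl)
  qed
  then have "(\<lambda>v. \<Sum>b\<in>Basis. h b v *\<^sub>R b) \<in> borel_measurable borel"
    by (intro borel_measurable_sum borel_measurable_scaleR) auto
  moreover have "(\<Sum>b\<in>Basis. h b (\<Phi> x) *\<^sub>R b) = x"
    if "x \<in> K" "\<forall>y\<in>K. \<Phi> y = \<Phi> x \<longrightarrow> y = x" for x
  proof -
    have "h b (\<Phi> x) = x \<bullet> b" for b
      using fibre[of "\<Phi> x" b] that by auto
    then show ?thesis by (simp add: euclidean_representation)
  qed
  ultimately show ?thesis
    by (intro bexI[of _ "\<lambda>v. \<Sum>b\<in>Basis. h b v *\<^sub>R b"]) auto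
qed

section \<open>Covers provided by the lower Minkowski dimension\<close>

text \<open>Compactness of the closure shows that the \<open>LEAST\<close> in
  \<open>covering_number\<close> is attained. Closing the balls of an optimal cover makes their
  finite union closed, so it contains the closure at no cost in number.\<close>

lemma finite_ball_cover_of_bounded:
  fixes S :: "(real^'n^'m) set"
  assumes "bounded S" "0 < \<rho>"
  shows "\<exists>C. finite C \<and> card C = covering_number S \<rho> \<and> closure S \<subseteq> (\<Union>c\<in>C. cball c \<rho>)"
proof -
  let ?P = "\<lambda>N. \<exists>C. finite C \<and> card C = N \<and> S \<subseteq> (\<Union>c\<in>C. {Y. frob_norm (Y - c) < \<rho>})"
  have balls: "{Y. frob_norm (Y - c) < \<rho>} = ball c \<rho>" for c :: "real^'n^'m"
    by (auto simp: frob_norm_eq_norm dist_norm norm_minus_commute)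
  have "compact (closure S)"
    using assms by simp
  then obtain C where "finite C" "closure S \<subseteq> (\<Union>c\<in>C. ball c \<rho>)"
    using compactE_image[of "closure S" UNIV "\<lambda>c. ball c \<rho>"] assms(2)
    by (metis UNIV_I centre_in_ball open_ball subsetI UN_I)
  then have "?P (card C)"
    unfolding balls using closure_subset by blast
  then have "?P (covering_number S \<rho>)"
    unfolding covering_number_def by (rule LeastI)
  then obtain C where C: "finite C" "card C = covering_number S \<rho>" "S \<subseteq> (\<Union>c\<in>C. ball c \<rho>)"
    unfolding balls by blast
  have "closure S \<subseteq> (\<Union>c\<in>C. cball c \<rho>)"
  proof (rule closure_minimal)
    show "S \<subseteq> (\<Union>c\<in>C. cball c \<rho>)" using C(3) by force
  qed (use C(1) in auto)
  then show ?thesis using C by blast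
qed

text \<open>A limit inferior controls only arbitrarily small radii, not all small ones; one good
  radius below each \<open>r\<close> suffices. The exponent \<open>t\<close> is fixed before
  \<open>r\<close> and leaves a gap below \<open>\<kappa>\<close>.\<close>

lemma small_covers_if_lower_box_dim_less:
  fixes S :: "(real^'n^'m) set"
  assumes S: "bounded S" and dim: "lower_box_dim S < ereal \<kappa>"
  shows "\<exists>t<\<kappa>. \<forall>r>0. \<exists>\<rho> C. 0 < \<rho> \<and> \<rho> < r \<and> finite C \<and> real (card C) \<le> \<rho> powr - t
           \<and> closure S \<subseteq> (\<Union>c\<in>C. cball c \<rho>)"
proof -
  from dim obtain t where t: "lower_box_dim S < ereal t" "t < \<kappa>"
    using ereal_dense2 by (metis ereal_less(1) less_ereal.simps(1))
  have "\<exists>\<rho> C. 0 < \<rho> \<and> \<rho> < r \<and> finite C \<and> real (card C) \<le> \<rho> powr - t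
           \<and> closure S \<subseteq> (\<Union>c\<in>C. cball c \<rho>)" if r: "0 < r" for r
  proof -
    \<comment> \<open>The cap at 1 keeps \<open>ln (1 / \<rho>)\<close> positive, so the quotient
      bound can be multiplied out.\<close>
    have "\<exists>\<rho>. 0 < \<rho> \<and> \<rho> < min r 1 \<and> ln (real (covering_number S \<rho>)) / ln (1 / \<rho>) < t"
    proof (rule ccontr)
      assume *: "\<not> ?thesis"
      have "eventually (\<lambda>\<rho>. \<rho> \<in> {0<..<min r 1}) (at_right (0::real))"
        using r by (intro eventually_at_right_real) auto
      then have "eventually (\<lambda>\<rho>. ereal t \<le> ereal (ln (real (covering_number S \<rho>)) / ln (1 / \<rho>))) (at_right 0)"
        by (rule eventually_mono) (use * in \<open>force simp: not_less\<close>)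
      then have "ereal t \<le> lower_box_dim S"
        unfolding lower_box_dim_def by (rule Liminf_bounded)
      with t show False by simp
    qed
    then obtain \<rho> where \<rho>: "0 < \<rho>" "\<rho> < r" "\<rho> < 1"
        "ln (real (covering_number S \<rho>)) / ln (1 / \<rho>) < t"
      by auto
    obtain C where C: "finite C" "card C = covering_number S \<rho>" "closure S \<subseteq> (\<Union>c\<in>C. cball c \<rho>)"
      using finite_ball_cover_of_bounded[OF S \<rho>(1)] by blast
    have "real (card C) \<le> \<rho> powr - t"
    proof (cases "card C = 0")
      case False
      have "0 < ln (1 / \<rho>)" using \<rho> by simp
      then have "ln (real (card C)) \<le> t * ln (1 / \<rho>)"
        using \<rho>(4) C(2) by (simp add: divide_less_eq)
      also have "\<dots> = ln (\<rho> powr - t)"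
        using \<rho> by (simp add: ln_powr ln_div)
      finally show ?thesis using False \<rho> by (subst (asm) ln_le_cancel_iff) auto
    qed simp
    then show ?thesis using C \<rho> by blast
  qed
  then show ?thesis using t by blast
qed

section \<open>Almost all measurements separate a fixed matrix from the compact set\<close>

definition annihilates :: "nat \<Rightarrow> (nat \<Rightarrow> (real^'m) \<times> (real^'n)) \<Rightarrow> real^'n^'m \<Rightarrow> bool" where
  "annihilates k w D \<longleftrightarrow> (\<forall>i<k. outer (fst (w i)) (snd (w i)) \<bullet> D = 0)"

text \<open>The cutoff \<open>d\<close> replaces the open condition \<open>y \<noteq> x\<close> by a
  closed one, so that projecting out \<open>y\<close> over \<open>K\<close> preserves
  closedness.\<close>

lemma closed_annihilated_difference:
  fixes K :: "(real^'n^'m) set"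
  assumes "compact K"
  shows "closed {(w, x). \<exists>y\<in>K. d \<le> norm (y - x) \<and> annihilates k w (y - x)}"
proof -
  let ?E = "\<lambda>i (p :: ((nat \<Rightarrow> (real^'m) \<times> (real^'n)) \<times> (real^'n^'m)) \<times> (real^'n^'m)).
    fst (fst (fst p) i) \<bullet> ((snd p - snd (fst p)) *v snd (fst (fst p) i))"
  have coord: "continuous_on UNIV (\<lambda>p. fst (fst p) i)"
    for i :: nat
    by (rule continuous_on_product_then_coordinatewise) (intro continuous_intros)
  have "continuous_on UNIV (?E i)" for i
    unfolding matrix_vector_mult_def inner_vec_def
    by (intro continuous_intros coord continuous_on_compose2[OF _ coord]) auto
  then have "closed {p. \<forall>i<k. ?E i p = 0}"
    by (intro closed_Collect_all closed_Collect_imp open_Collect_const closed_Collect_eq continuous_on_const)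
  moreover have "closed {p :: ((nat \<Rightarrow> (real^'m) \<times> (real^'n)) \<times> (real^'n^'m)) \<times> (real^'n^'m).
      d \<le> norm (snd p - snd (fst p))}"
    by (intro closed_Collect_le continuous_intros)
  ultimately have "closed ({p :: ((nat \<Rightarrow> (real^'m) \<times> (real^'n)) \<times> (real^'n^'m)) \<times> (real^'n^'m).
      d \<le> norm (snd p - snd (fst p))} \<inter> {p. \<forall>i<k. ?E i p = 0})"
    by (rule closed_Int[rotated])
  from closed_exists_compact[OF assms this] show ?thesis
    by (auto simp: annihilates_def inner_outer case_prod_unfold elim!: back_subst[where P = closed])
qed

lemma sets_annihilated_difference:
  fixes K :: "(real^'n^'m) set"
  assumes K: "compact K" and X: "X \<in> borel_measurable M"
  shows "{z \<in> space (PiM {..<k} (\<lambda>_. lborel) \<Otimes>\<^sub>M M).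
      \<exists>y\<in>K. d \<le> norm (y - X (snd z)) \<and> annihilates k (fst z) (y - X (snd z))}
    \<in> sets (PiM {..<k} (\<lambda>_. lborel) \<Otimes>\<^sub>M M)"
proof -
  let ?N = "PiM {..<k} (\<lambda>_. lborel :: ((real^'m) \<times> (real^'n)) measure) \<Otimes>\<^sub>M M"
  have "(\<lambda>z. (fst z, X (snd z))) \<in> measurable ?N (borel \<Otimes>\<^sub>M borel)"
    using measurable_compose[OF measurable_fst measurable_ident_PiM_borel] measurable_compose[OF measurable_snd X]
    by (intro measurable_Pair)
  then have "(\<lambda>z. (fst z, X (snd z))) \<in> borel_measurable ?N"
    by (simp add: borel_prod)
  from measurable_sets[OF this borel_closed[OF closed_annihilated_difference[OF K, of d k]]]
  show ?thesis
    by (auto simp: vimage_def Int_def conj_commute elim!: back_subst[where P = "\<lambda>A. A \<in> sets ?N"])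
qed

lemma sets_annihilated_difference_section:
  fixes K :: "(real^'n^'m) set"
  assumes K: "compact K"
  shows "{w \<in> space (PiM {..<k} (\<lambda>_. lborel)). \<exists>y\<in>K. d \<le> norm (y - x) \<and> annihilates k w (y - x)}
    \<in> sets (PiM {..<k} (\<lambda>_. lborel))"
proof -
  let ?N = "PiM {..<k} (\<lambda>_. lborel :: ((real^'m) \<times> (real^'n)) measure)"
  have "(\<lambda>w. (w, x)) \<in> measurable ?N (borel \<Otimes>\<^sub>M borel)"
    using measurable_ident_PiM_borel by (intro measurable_Pair) auto
  then have "(\<lambda>w. (w, x)) \<in> borel_measurable ?N"
    by (simp add: borel_prod)
  from measurable_sets[OF this borel_closed[OF closed_annihilated_difference[OF K, of d k]]]
  show ?thesis
    by (auto simp: vimage_def Int_def conj_commute elim!: back_subst[where P = "\<lambda>A. A \<in> sets ?N"])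
qed

text \<open>If \<open>w\<close> annihilates \<open>y - x\<close> and \<open>y\<close> lies in the
  ball around \<open>c\<close>, then each measurement of \<open>Y c - x\<close> equals that of
  \<open>Y c - y\<close>, hence is at most \<open>R\<^sup>2 * (2 * \<rho>)\<close> in size. One set
  per ball thus covers the bad \<open>w\<close>, and the product measure raises the single bound to
  the power \<open>k\<close>.\<close>

lemma emeasure_annihilated_difference_le:
  fixes K :: "(real^'n^'m) set"
  assumes C: "\<And>(D :: real^'n^'m) \<tau>. d \<le> norm D \<Longrightarrow> 0 < \<tau> \<Longrightarrow>
     emeasure lborel {z \<in> cball 0 R \<times> cball 0 R. \<bar>fst z \<bullet> (D *v snd z)\<bar> \<le> \<tau>} \<le> ennreal (C * \<tau> powr s)"
    and "0 \<le> C" and R: "0 < R" and \<rho>: "0 < \<rho>" and A: "finite A" "K \<subseteq> (\<Union>c\<in>A. cball c \<rho>)"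
  shows "emeasure (PiM {..<k} (\<lambda>_. lborel))
      {w \<in> space (PiM {..<k} (\<lambda>_. lborel)). (\<forall>i<k. w i \<in> cball 0 R \<times> cball 0 R) \<and>
        (\<exists>y\<in>K. d \<le> norm (y - x) \<and> annihilates k w (y - x))}
     \<le> ennreal (real (card A) * (C * (2 * R\<^sup>2 * \<rho>) powr s) ^ k)"
proof -
  interpret product_sigma_finite "\<lambda>_::nat. lborel :: ((real^'m) \<times> (real^'n)) measure"
    by standard
  let ?N = "PiM {..<k} (\<lambda>_. lborel :: ((real^'m) \<times> (real^'n)) measure)"
  define \<tau> where "\<tau> = 2 * R\<^sup>2 * \<rho>"
  have \<tau>: "0 < \<tau>" using R \<rho> by (simp add: \<tau>_def)
  define T where "T = (\<lambda>D::real^'n^'m. {z \<in> cball 0 R \<times> cball 0 R. \<bar>fst z \<bullet> (D *v snd z)\<bar> \<le> \<tau>})"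
  have T_closed: "closed (T D)" for D
  proof -
    have "closed {z :: (real^'m) \<times> (real^'n). \<bar>fst z \<bullet> (D *v snd z)\<bar> \<le> \<tau>}"
      unfolding matrix_vector_mult_def inner_vec_def by (intro closed_Collect_le continuous_intros)
    moreover have "T D = (cball 0 R \<times> cball 0 R) \<inter> {z. \<bar>fst z \<bullet> (D *v snd z)\<bar> \<le> \<tau>}"
      by (auto simp: T_def)
    ultimately show ?thesis
      by (simp add: closed_Int closed_Times)
  qed
  \<comment> \<open>A representative in \<open>K\<close> is used rather than the centre
    \<open>c\<close>, so that the distance to \<open>x\<close> stays at least \<open>d\<close>
    without loss.\<close>
  define Y where "Y = (\<lambda>c. SOME y. y \<in> K \<inter> cball c \<rho> \<and> d \<le> norm (y - x))"
  define B where "B = {c \<in> A. \<exists>y. y \<in> K \<inter> cball c \<rho> \<and> d \<le> norm (y - x)}"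
  have Y: "Y c \<in> K \<inter> cball c \<rho> \<and> d \<le> norm (Y c - x)" if "c \<in> B" for c
    unfolding Y_def by (rule someI_ex) (use that in \<open>simp add: B_def\<close>)
  have "{w \<in> space ?N. (\<forall>i<k. w i \<in> cball 0 R \<times> cball 0 R) \<and>
      (\<exists>y\<in>K. d \<le> norm (y - x) \<and> annihilates k w (y - x))}
    \<subseteq> (\<Union>c\<in>B. PiE {..<k} (\<lambda>_. T (Y c - x)))"
  proof safe
    fix w y assume w: "w \<in> space ?N" "\<forall>i<k. w i \<in> cball 0 R \<times> cball 0 R"
      and y: "y \<in> K" "d \<le> norm (y - x)" "annihilates k w (y - x)"
    from y(1) A(2) obtain c where c: "c \<in> A" "y \<in> cball c \<rho>" by auto
    then have cB: "c \<in> B" using y by (auto simp: B_def)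
    have near: "norm (Y c - y) \<le> 2 * \<rho>"
      using Y[OF cB] c(2) norm_triangle_ineq[of "Y c - c" "c - y"]
      by (auto simp: dist_norm norm_minus_commute)
    have "w i \<in> T (Y c - x)" if i: "i < k" for i
    proof -
      have R': "norm (fst (w i)) \<le> R" "norm (snd (w i)) \<le> R"
        using w(2) i by (auto simp: mem_Times_iff)
      have "outer (fst (w i)) (snd (w i)) \<bullet> (Y c - x) = outer (fst (w i)) (snd (w i)) \<bullet> (Y c - y)"
        using y(3) i by (auto simp: annihilates_def inner_diff_right)
      then have "\<bar>outer (fst (w i)) (snd (w i)) \<bullet> (Y c - x)\<bar> \<le> norm (outer (fst (w i)) (snd (w i))) * norm (Y c - y)"
        by (simp add: Cauchy_Schwarz_ineq2)
      also have "\<dots> \<le> (R * R) * (2 * \<rho>)"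
        unfolding norm_outer using R' near R \<rho> by (intro mult_mono) auto
      finally show ?thesis
        using w(2) i by (simp add: T_def \<tau>_def inner_outer power2_eq_square)
    qed
    moreover have "w \<in> extensional {..<k}" using w(1) by (simp add: space_PiM PiE_def)
    ultimately show "w \<in> (\<Union>c\<in>B. PiE {..<k} (\<lambda>_. T (Y c - x)))"
      using cB by (auto simp: PiE_def)
  qed
  then have "emeasure ?N {w \<in> space ?N. (\<forall>i<k. w i \<in> cball 0 R \<times> cball 0 R) \<and>
      (\<exists>y\<in>K. d \<le> norm (y - x) \<and> annihilates k w (y - x))}
    \<le> emeasure ?N (\<Union>c\<in>B. PiE {..<k} (\<lambda>_. T (Y c - x)))"
    using A(1) T_closed by (intro emeasure_mono sets.finite_UN sets_PiM_I_finite) (auto simp: B_def)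
  also have "\<dots> \<le> (\<Sum>c\<in>B. emeasure ?N (PiE {..<k} (\<lambda>_. T (Y c - x))))"
    using A(1) T_closed by (intro emeasure_subadditive_finite) (auto simp: B_def intro!: sets_PiM_I_finite)
  also have "\<dots> \<le> (\<Sum>c\<in>B. ennreal ((C * \<tau> powr s) ^ k))"
  proof (rule sum_mono)
    fix c assume "c \<in> B"
    have "emeasure ?N (PiE {..<k} (\<lambda>_. T (Y c - x))) = emeasure lborel (T (Y c - x)) ^ k"
      using T_closed by (subst emeasure_PiM) auto
    also have "\<dots> \<le> ennreal (C * \<tau> powr s) ^ k"
      unfolding T_def using Y[OF \<open>c \<in> B\<close>] \<tau> by (intro power_mono C) auto
    also have "\<dots> = ennreal ((C * \<tau> powr s) ^ k)"
      using \<open>0 \<le> C\<close> by (intro ennreal_power) auto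
    finally show "emeasure ?N (PiE {..<k} (\<lambda>_. T (Y c - x))) \<le> ennreal ((C * \<tau> powr s) ^ k)" .
  qed
  also have "\<dots> = ennreal (real (card B) * (C * \<tau> powr s) ^ k)"
    using \<open>0 \<le> C\<close> by (simp add: ennreal_mult ennreal_of_nat_eq_real_of_nat)
  also have "\<dots> \<le> ennreal (real (card A) * (C * \<tau> powr s) ^ k)"
    using \<open>0 \<le> C\<close> A(1) by (intro ennreal_leI mult_right_mono) (auto simp: B_def intro!: card_mono)
  finally show ?thesis by (simp add: \<tau>_def)
qed

lemma AE_not_annihilated_difference:
  fixes K :: "(real^'n^'m) set"
  assumes K: "compact K" and t: "t < real k"
    and cover: "\<And>r. 0 < r \<Longrightarrow> \<exists>\<rho> A. 0 < \<rho> \<and> \<rho> < r \<and> finite A \<and> real (card A) \<le> \<rho> powr - t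
           \<and> K \<subseteq> (\<Union>c\<in>A. cball c \<rho>)"
  shows "AE w in PiM {..<k} (\<lambda>_. lborel). \<forall>y\<in>K. annihilates k w (y - x) \<longrightarrow> y = x"
proof -
  let ?N = "PiM {..<k} (\<lambda>_. lborel :: ((real^'m) \<times> (real^'n)) measure)"
  \<comment> \<open>Midpoint between \<open>t / k\<close> and 1, giving \<open>t < s * k\<close>.
    The maximum with \<open>1/2\<close> keeps \<open>s\<close> positive if \<open>t\<close> is
    negative; for \<open>k = 0\<close> the hypothesis gives \<open>t < 0\<close>, as
    required.\<close>
  define s where "s = max (1/2) ((t / k + 1) / 2)"
  have s: "0 < s" "s < 1" "t < s * k"
  proof -
    show "0 < s" "s < 1" using t by (cases "k = 0"; simp add: s_def divide_less_eq)+
    show "t < s * k"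
    proof (cases "k = 0")
      case False
      then have "t / k < 1" using t by (simp add: divide_less_eq)
      moreover have "u < (u + 1) / 2" if "u < 1" for u :: real using that by simp
      ultimately have "t / k < (t / k + 1) / 2" by blast
      then have "t / k < s" unfolding s_def by (rule less_le_trans) (rule max.cobounded2)
      then show ?thesis using False by (simp add: divide_less_eq)
    qed (use t in simp)
  qed
  have local: "AE w in ?N. \<not> ((\<forall>i<k. w i \<in> cball 0 R \<times> cball 0 R) \<and>
        (\<exists>y\<in>K. d \<le> norm (y - x) \<and> annihilates k w (y - x)))" if R: "0 < R" and d: "0 < d" for R d
  proof (rule AE_I)
    let ?E = "{w \<in> space ?N. (\<forall>i<k. w i \<in> cball 0 R \<times> cball 0 R) \<and>
        (\<exists>y\<in>K. d \<le> norm (y - x) \<and> annihilates k w (y - x))}"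
    have "{w \<in> space ?N. \<forall>i\<in>{..<k}. w i \<in> cball 0 R \<times> cball 0 R} \<in> sets ?N"
    proof (intro sets.sets_Collect_finite_All)
      fix i assume "i \<in> {..<k}"
      then have "(\<lambda>w. w i) -` (cball 0 R \<times> cball 0 R) \<inter> space ?N \<in> sets ?N"
        by (intro measurable_sets[OF measurable_component_singleton])
          (auto intro!: borel_closed closed_Times)
      then show "{w \<in> space ?N. w i \<in> cball 0 R \<times> cball 0 R} \<in> sets ?N"
        by (simp add: vimage_def Int_def conj_commute)
    qed auto
    then have "{w \<in> space ?N. \<forall>i\<in>{..<k}. w i \<in> cball 0 R \<times> cball 0 R}
      \<inter> {w \<in> space ?N. \<exists>y\<in>K. d \<le> norm (y - x) \<and> annihilates k w (y - x)} \<in> sets ?N"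
      using sets_annihilated_difference_section[OF K] by (rule sets.Int)
    also have "{w \<in> space ?N. \<forall>i\<in>{..<k}. w i \<in> cball 0 R \<times> cball 0 R}
      \<inter> {w \<in> space ?N. \<exists>y\<in>K. d \<le> norm (y - x) \<and> annihilates k w (y - x)} = ?E"
      by auto
    finally show "?E \<in> sets ?N" .
    obtain C where C: "0 \<le> C" "\<And>(D :: real^'n^'m) \<tau>. d \<le> norm D \<Longrightarrow> 0 < \<tau> \<Longrightarrow>
     emeasure lborel {z \<in> cball 0 R \<times> cball 0 R. \<bar>fst z \<bullet> (D *v snd z)\<bar> \<le> \<tau>} \<le> ennreal (C * \<tau> powr s)"
      using emeasure_bilinear_small_le[OF s(1,2) less_imp_le[OF R] d] by blast
    define B where "B = (C * (2 * R\<^sup>2) powr s) ^ k"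
    have B: "0 \<le> B" using C by (simp add: B_def)
    have small: "emeasure ?N ?E \<le> ennreal e" if e: "0 < e" for e
    proof -
      \<comment> \<open>At most \<open>\<rho> powr - t\<close> balls, each contributing
        \<open>\<rho> powr (s * k)\<close> up to the factor \<open>B\<close>: the exponent
        \<open>s * k - t\<close> is positive, so the total tends to 0.\<close>
      have "((\<lambda>\<rho>. B * \<rho> powr (s * k - t)) \<longlongrightarrow> B * 0 powr (s * k - t)) (at_right 0)"
        using s by (intro tendsto_intros tendsto_powr' tendsto_ident_at) (auto simp: eventually_at_filter)
      then have "eventually (\<lambda>\<rho>. B * \<rho> powr (s * k - t) < e) (at_right 0)"
        using e by (intro order_tendstoD) auto
      then obtain r where r: "0 < r" "\<And>\<rho>. 0 < \<rho> \<Longrightarrow> \<rho> < r \<Longrightarrow> B * \<rho> powr (s * k - t) < e"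
        unfolding eventually_at_right_field by blast
      obtain \<rho> A where \<rho>: "0 < \<rho>" "\<rho> < r" "finite A" "real (card A) \<le> \<rho> powr - t" "K \<subseteq> (\<Union>c\<in>A. cball c \<rho>)"
        using cover[OF r(1)] by blast
      have "(2 * R\<^sup>2 * \<rho>) powr s = (2 * R\<^sup>2) powr s * \<rho> powr s"
        by (rule powr_mult)
      moreover have "(\<rho> powr s) ^ k = \<rho> powr (s * k)"
        using powr_power[of \<rho> s k] \<rho>(1) by (simp add: mult.commute)
      ultimately have "real (card A) * (C * (2 * R\<^sup>2 * \<rho>) powr s) ^ k
          = real (card A) * (B * \<rho> powr (s * k))"
        by (simp add: B_def power_mult_distrib)
      also have "\<dots> \<le> \<rho> powr - t * (B * \<rho> powr (s * k))"
        using \<rho>(4) B by (intro mult_right_mono) auto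
      also have "\<dots> = B * (\<rho> powr - t * \<rho> powr (s * k))"
        by (rule mult.left_commute)
      also have "\<rho> powr - t * \<rho> powr (s * k) = \<rho> powr (s * k - t)"
        by (simp add: powr_add[symmetric])
      also have "B * \<rho> powr (s * k - t) < e" using r(2) \<rho>(1,2) .
      finally have "real (card A) * (C * (2 * R\<^sup>2 * \<rho>) powr s) ^ k \<le> e" by (rule less_imp_le)
      have "emeasure ?N ?E \<le> ennreal (real (card A) * (C * (2 * R\<^sup>2 * \<rho>) powr s) ^ k)"
        by (rule emeasure_annihilated_difference_le[OF C(2,1) R \<rho>(1,3,5)])
      also have "\<dots> \<le> ennreal e"
        by (rule ennreal_leI) fact
      finally show ?thesis .
    qed
    show "emeasure ?N ?E = 0"
    proof (rule antisym)
      show "emeasure ?N ?E \<le> 0"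
        by (rule ennreal_le_epsilon) (use small in \<open>simp only: add_0\<close>)
    qed (rule zero_le)
  qed auto
  \<comment> \<open>Countably many radii and cutoffs exhaust all \<open>w\<close> and all
    \<open>y \<noteq> x\<close>.\<close>
  have "AE w in ?N. \<forall>p q. \<not> ((\<forall>i<k. w i \<in> cball 0 (real (Suc p)) \<times> cball 0 (real (Suc p))) \<and>
        (\<exists>y\<in>K. 1 / real (Suc q) \<le> norm (y - x) \<and> annihilates k w (y - x)))"
    unfolding AE_all_countable by (intro allI local) auto
  then show ?thesis
  proof (rule eventually_mono)
    fix w
    assume w: "\<forall>p q. \<not> ((\<forall>i<k. w i \<in> cball 0 (real (Suc p)) \<times> cball 0 (real (Suc p))) \<and>
        (\<exists>y\<in>K. 1 / real (Suc q) \<le> norm (y - x) \<and> annihilates k w (y - x)))"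
    show "\<forall>y\<in>K. annihilates k w (y - x) \<longrightarrow> y = x"
    proof (intro ballI impI, rule ccontr)
      fix y assume y: "y \<in> K" "annihilates k w (y - x)" "y \<noteq> x"
      obtain q where "inverse (real (Suc q)) < norm (y - x)"
        using reals_Archimedean[of "norm (y - x)"] y(3) by auto
      then have q: "1 / real (Suc q) \<le> norm (y - x)" by (simp add: inverse_eq_divide)
      obtain p :: nat where p: "(\<Sum>i<k. norm (fst (w i)) + norm (snd (w i))) \<le> real p"
        using real_arch_simple by blast
      have "w i \<in> cball 0 (real (Suc p)) \<times> cball 0 (real (Suc p))" if "i < k" for i
      proof -
        have "norm (fst (w i)) + norm (snd (w i)) \<le> (\<Sum>i<k. norm (fst (w i)) + norm (snd (w i)))"
          by (rule member_le_sum) (use that in auto)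
        with p have "norm (fst (w i)) + norm (snd (w i)) \<le> real p" by linarith
        then have "norm (fst (w i)) \<le> 1 + real p" "norm (snd (w i)) \<le> 1 + real p"
          using norm_ge_zero[of "fst (w i)"] norm_ge_zero[of "snd (w i)"] by linarith+
        then show ?thesis by (simp add: mem_Times_iff)
      qed
      then show False using w q y by blast
    qed
  qed
qed

section \<open>Exchange of the quantifiers and the decoding theorem\<close>

text \<open>The fixed-matrix result applies with \<open>x = X \<omega>\<close> for every
  \<open>\<omega>\<close>. Joint measurability of the good set then allows \<open>AE_commute\<close>
  to swap the two quantifiers.\<close>

lemma AE_AE_not_annihilated_difference:
  fixes K :: "(real^'n^'m) set"
  assumes M: "sigma_finite_measure M" and X: "X \<in> borel_measurable M" and K: "compact K" and t: "t < real k"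
    and cover: "\<And>r. 0 < r \<Longrightarrow> \<exists>\<rho> A. 0 < \<rho> \<and> \<rho> < r \<and> finite A \<and> real (card A) \<le> \<rho> powr - t
           \<and> K \<subseteq> (\<Union>c\<in>A. cball c \<rho>)"
  shows "AE w in PiM {..<k} (\<lambda>_. lborel). AE \<omega> in M. \<forall>y\<in>K. annihilates k w (y - X \<omega>) \<longrightarrow> y = X \<omega>"
proof -
  let ?N = "PiM {..<k} (\<lambda>_. lborel :: ((real^'m) \<times> (real^'n)) measure)"
  interpret P: finite_product_sigma_finite "\<lambda>_::nat. lborel :: ((real^'m) \<times> (real^'n)) measure" "{..<k}"
    by standard auto
  interpret M: sigma_finite_measure M by fact
  interpret pair_sigma_finite ?N M ..
  let ?B = "\<lambda>q. {z \<in> space (?N \<Otimes>\<^sub>M M).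
      \<exists>y\<in>K. 1 / real (Suc q) \<le> norm (y - X (snd z)) \<and> annihilates k (fst z) (y - X (snd z))}"
  \<comment> \<open>Equality is written through countably many cutoffs, which turns the bad set into
    the countable union of the measurable sets \<open>?B q\<close>.\<close>
  have sep: "y = x \<longleftrightarrow> (\<forall>q. \<not> 1 / real (Suc q) \<le> norm (y - x))" for x y :: "real^'n^'m"
    using reals_Archimedean[of "norm (y - x)"]
    by (auto simp: inverse_eq_divide not_le) (meson less_asym)
  have "space (?N \<Otimes>\<^sub>M M) - (\<Union>q. ?B q) \<in> sets (?N \<Otimes>\<^sub>M M)"
    by (intro sets.Diff sets.countable_UN sets.top) (auto intro!: sets_annihilated_difference[OF K X])
  also have "space (?N \<Otimes>\<^sub>M M) - (\<Union>q. ?B q) = {z \<in> space (?N \<Otimes>\<^sub>M M).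
      \<forall>y\<in>K. annihilates k (fst z) (y - X (snd z)) \<longrightarrow> y = X (snd z)}"
    unfolding sep by blast
  finally show ?thesis
    using AE_not_annihilated_difference[OF K t cover]
    by (subst AE_commute) auto
qed

theorem theorem2:
  fixes M :: "'a measure" and X :: "'a \<Rightarrow> real^'n^'m"
    and S :: "(real^'n^'m) set" and \<epsilon> :: real and k :: nat
  assumes "prob_space M"
    and "X \<in> borel_measurable M"
    and "\<epsilon> \<ge> 0"
    and "eps_support M X \<epsilon> S"
    and "ereal (real k) > lower_box_dim S"
  shows "AE w in PiM {..<k} (\<lambda>_. lborel :: ((real^'m) \<times> (real^'n)) measure).
           \<exists>g :: (nat \<Rightarrow> real) \<Rightarrow> real^'n^'m.
             g \<in> borel_measurable (PiM {..<k} (\<lambda>_. lborel)) \<and>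
             measure M {\<omega> \<in> space M.
                g (\<lambda>i\<in>{..<k}. frob_inner (outer (fst (w i)) (snd (w i))) (X \<omega>)) \<noteq> X \<omega>}
               \<le> \<epsilon>"
proof -
  interpret prob_space M by fact
  note X [measurable] = assms(2)
  have S: "bounded S" "{\<omega> \<in> space M. X \<omega> \<in> S} \<in> events" "1 - \<epsilon> \<le> prob {\<omega> \<in> space M. X \<omega> \<in> S}"
    using assms(4) by (auto simp: eps_support_def)
  have K: "compact (closure S)" using S(1) by simp
  obtain t where t: "t < real k"
    and cover: "\<And>r. 0 < r \<Longrightarrow> \<exists>\<rho> A. 0 < \<rho> \<and> \<rho> < r \<and> finite A \<and> real (card A) \<le> \<rho> powr - t
           \<and> closure S \<subseteq> (\<Union>c\<in>A. cball c \<rho>)"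
    using small_covers_if_lower_box_dim_less[OF S(1) assms(5)] by blast
  have "AE w in PiM {..<k} (\<lambda>_. lborel). AE \<omega> in M.
      \<forall>y\<in>closure S. annihilates k w (y - X \<omega>) \<longrightarrow> y = X \<omega>"
    by (rule AE_AE_not_annihilated_difference[OF sigma_finite_measure_axioms X K t cover])
  then show ?thesis
  proof (rule eventually_mono)
    fix w :: "nat \<Rightarrow> (real^'m) \<times> (real^'n)"
    assume w: "AE \<omega> in M. \<forall>y\<in>closure S. annihilates k w (y - X \<omega>) \<longrightarrow> y = X \<omega>"
    define \<Phi> where "\<Phi> = (\<lambda>Y. \<lambda>i\<in>{..<k}. frob_inner (outer (fst (w i)) (snd (w i))) Y)"
    have "continuous_on (closure S) (\<lambda>Y. \<Phi> Y i)" for i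
      by (cases "i < k") (auto simp: \<Phi>_def frob_inner_eq_inner intro!: continuous_intros)
    then have "continuous_on (closure S) \<Phi>"
      by (rule continuous_on_coordinatewise_then_product)
    then obtain g where g: "g \<in> borel_measurable borel"
      "\<forall>x\<in>closure S. (\<forall>y\<in>closure S. \<Phi> y = \<Phi> x \<longrightarrow> y = x) \<longrightarrow> g (\<Phi> x) = x"
      using measurable_left_inverse_on_compact[OF K] by blast
    have g_meas [measurable]: "g \<in> borel_measurable (PiM {..<k} (\<lambda>_. lborel))"
      using measurable_compose[OF measurable_ident_PiM_borel g(1)] .
    have \<Phi>_eq: "annihilates k w (y - x)" if "\<Phi> y = \<Phi> x" for x y
      using fun_cong[OF that] by (auto simp: annihilates_def \<Phi>_def frob_inner_eq_inner inner_diff_right restrict_def split: if_splits) metis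
    have "\<Phi> \<in> measurable borel (PiM {..<k} (\<lambda>_. lborel))"
      unfolding \<Phi>_def frob_inner_eq_inner by (intro measurable_restrict) simp
    then have "(\<lambda>\<omega>. g (\<Phi> (X \<omega>))) \<in> borel_measurable M"
      by (intro measurable_compose[OF _ g_meas] measurable_compose[OF X])
    then have bad: "{\<omega> \<in> space M. g (\<Phi> (X \<omega>)) \<noteq> X \<omega>} \<in> events"
      by measurable
    \<comment> \<open>Almost surely a decoding error forces \<open>X \<omega>\<close> out of
      \<open>S\<close>: a value in \<open>S\<close> lies in the closure, is separated there from all
      other points, and is therefore recovered by \<open>g\<close>.\<close>
    have "prob {\<omega> \<in> space M. g (\<Phi> (X \<omega>)) \<noteq> X \<omega>} \<le> prob (space M - {\<omega> \<in> space M. X \<omega> \<in> S})"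
    proof (rule finite_measure_mono_AE)
      show "AE \<omega> in M. \<omega> \<in> {\<omega> \<in> space M. g (\<Phi> (X \<omega>)) \<noteq> X \<omega>} \<longrightarrow> \<omega> \<in> space M - {\<omega> \<in> space M. X \<omega> \<in> S}"
        using w
      proof (rule eventually_mono)
        fix \<omega> assume "\<forall>y\<in>closure S. annihilates k w (y - X \<omega>) \<longrightarrow> y = X \<omega>"
        then have "X \<omega> \<in> S \<Longrightarrow> g (\<Phi> (X \<omega>)) = X \<omega>"
          using g(2) \<Phi>_eq closure_subset by blast
        then show "\<omega> \<in> {\<omega> \<in> space M. g (\<Phi> (X \<omega>)) \<noteq> X \<omega>} \<longrightarrow> \<omega> \<in> space M - {\<omega> \<in> space M. X \<omega> \<in> S}"
          by auto
      qed
    qed (use S(2) in auto)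
    also have "\<dots> \<le> \<epsilon>"
      using S(2,3) by (simp add: prob_compl)
    finally show "\<exists>g :: (nat \<Rightarrow> real) \<Rightarrow> real^'n^'m.
             g \<in> borel_measurable (PiM {..<k} (\<lambda>_. lborel)) \<and>
             measure M {\<omega> \<in> space M.
                g (\<lambda>i\<in>{..<k}. frob_inner (outer (fst (w i)) (snd (w i))) (X \<omega>)) \<noteq> X \<omega>}
               \<le> \<epsilon>"
      using g_meas unfolding \<Phi>_def by blast
  qed
qed

end
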